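(* Let $\mathbb{K}$ be an algebraically closed field of characteristic zero and $p\in\mathbb{K}[x]$. The $\mathfrak{sl}_2$-module $V(p)$ is simple if and only if $p(0)\notin-\mathbb{N}=\{0,-1,-2,\ldots\}$. Otherwise $V(p(x))$ has length $2$ and there is a short exact sequence of $\mathfrak{sl}_2$-modules \[0\to V\big(p(x)-2p(0)+2\big)\to V(p(x))\to L(-p(0))\to 0,\] where $L(-p(0))$ is the simple highest weight module of highest weight $-p(0)\in\mathbb{N}$.
   Context: $\mathfrak{sl}_2=\mathfrak{sl}_2(\mathbb{K})$ has the standard basis $\{x,y,h\}$ with $[h,x]=2x$, $[h,y]=-2y$, $[x,y]=h$. $\mathbb{N}$ denotes the nonnegative integers. For $p\in\mathbb{K}[x]$ let $q(x):=-\frac{1}{2x}\int_0^x\big(p(t)p'(t)+tp''(t)\big)dt$ (formal integral of polynomials). $V(p)$ denotes the vector space $\mathbb{K}[x]$ with the $\mathfrak{sl}_2$-module structure $x\cdot f=xf$, $h\cdot f=pf+2xf'$, $y\cdot f=qf-pf'-xf''$. For $m\in\mathbb{N}$, $L(m)$ is the simple $\mathfrak{sl}_2$-module of highest weight $m$ (where the highest weight vector is annihilated by $x$ and $h$ acts on it by $m$); it has dimension $m+1$. *)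

theory Defs
  imports
    "HOL-Analysis.Determinants"
    "HOL-Computational_Algebra.Polynomial"
    "HOL-Library.Extended_Nat"
begin

definition sl2 :: "('a::field^2^2) set" where
  "sl2 = {A. trace A = 0}"

definition bracket :: "'a::field^2^2 \<Rightarrow> 'a^2^2 \<Rightarrow> 'a^2^2" where
  "bracket A B = A ** B - B ** A"

definition scale_mat :: "'a::field \<Rightarrow> 'a^2^2 \<Rightarrow> 'a^2^2" where
  "scale_mat c A = (\<chi> i j. c * A $ i $ j)"

definition sl2_x :: "'a::field^2^2" where
  "sl2_x = vector [vector [0, 1], vector [0, 0]]"

definition sl2_y :: "'a::field^2^2" where
  "sl2_y = vector [vector [0, 0], vector [1, 0]]"

definition sl2_h :: "'a::field^2^2" where
  "sl2_h = vector [vector [1, 0], vector [0, -1]]"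

lemmas sl2_basis_defs = sl2_x_def sl2_y_def sl2_h_def

lemma sl2_basis_mem: "sl2_x \<in> sl2" "sl2_y \<in> sl2" "sl2_h \<in> sl2"
  by (simp_all add: sl2_def sl2_basis_defs trace_def sum_2)

lemma sl2_basis_brackets:
  "bracket sl2_h sl2_x = scale_mat 2 sl2_x"
  "bracket sl2_h sl2_y = scale_mat (-2) sl2_y"
  "bracket sl2_x sl2_y = sl2_h"
  by (simp_all add: bracket_def scale_mat_def sl2_basis_defs matrix_matrix_mult_def
      vec_eq_iff forall_2 sum_2)

lemma sl2_basis_expansion:
  assumes "A \<in> sl2"
  shows "A = scale_mat (A $ 1 $ 1) sl2_h + scale_mat (A $ 1 $ 2) sl2_x + scale_mat (A $ 2 $ 1) sl2_y"
  using assms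
  by (simp add: sl2_def trace_def scale_mat_def sl2_basis_defs vec_eq_iff forall_2 sum_2
      eq_neg_iff_add_eq_0 add.commute)

text \<open>
  The underlying vector space of a module is a subspace \<open>carrier\<close> of an ambient vector space whose
  addition is that of the type \<open>'v\<close> and whose scalar multiplication is \<open>scale\<close>.  Values of
  \<open>act\<close> outside \<open>sl2\<close> and outside the carrier are irrelevant.
\<close>

record ('a, 'v) sl2_mod =
  carrier :: "'v set"
  scale :: "'a \<Rightarrow> 'v \<Rightarrow> 'v"
  act :: "'a^2^2 \<Rightarrow> 'v \<Rightarrow> 'v"

definition sl2_module :: "('a::field, 'v::ab_group_add) sl2_mod \<Rightarrow> bool" where
  "sl2_module M \<longleftrightarrow>
     vector_space (scale M) \<and>
     module.subspace (scale M) (carrier M) \<and>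
     (\<forall>A\<in>sl2. \<forall>v\<in>carrier M. act M A v \<in> carrier M) \<and>
     (\<forall>A\<in>sl2. \<forall>v\<in>carrier M. \<forall>w\<in>carrier M. act M A (v + w) = act M A v + act M A w) \<and>
     (\<forall>A\<in>sl2. \<forall>c. \<forall>v\<in>carrier M. act M A (scale M c v) = scale M c (act M A v)) \<and>
     (\<forall>A\<in>sl2. \<forall>B\<in>sl2. \<forall>v\<in>carrier M. act M (A + B) v = act M A v + act M B v) \<and>
     (\<forall>A\<in>sl2. \<forall>c. \<forall>v\<in>carrier M. act M (scale_mat c A) v = scale M c (act M A v)) \<and>
     (\<forall>A\<in>sl2. \<forall>B\<in>sl2. \<forall>v\<in>carrier M.
        act M (bracket A B) v = act M A (act M B v) - act M B (act M A v))"

definition sl2_submodule :: "'v set \<Rightarrow> ('a::field, 'v::ab_group_add) sl2_mod \<Rightarrow> bool" where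
  "sl2_submodule N M \<longleftrightarrow>
     N \<subseteq> carrier M \<and> module.subspace (scale M) N \<and>
     (\<forall>A\<in>sl2. \<forall>v\<in>N. act M A v \<in> N)"

definition sl2_simple :: "('a::field, 'v::ab_group_add) sl2_mod \<Rightarrow> bool" where
  "sl2_simple M \<longleftrightarrow>
     sl2_module M \<and> carrier M \<noteq> {0} \<and>
     (\<forall>N. sl2_submodule N M \<longrightarrow> N = {0} \<or> N = carrier M)"

definition sl2_length :: "('a::field, 'v::ab_group_add) sl2_mod \<Rightarrow> enat" where
  "sl2_length M =
     Sup {enat n | n. \<exists>N. (\<forall>i\<le>n. sl2_submodule (N i) M) \<and> (\<forall>i<n. N i \<subset> N (Suc i))}"

definition sl2_hom ::
  "('a::field, 'v::ab_group_add) sl2_mod \<Rightarrow> ('a, 'w::ab_group_add) sl2_mod \<Rightarrow> ('v \<Rightarrow> 'w) \<Rightarrow> bool" where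
  "sl2_hom M N f \<longleftrightarrow>
     (\<forall>v\<in>carrier M. f v \<in> carrier N) \<and>
     (\<forall>v\<in>carrier M. \<forall>w\<in>carrier M. f (v + w) = f v + f w) \<and>
     (\<forall>c. \<forall>v\<in>carrier M. f (scale M c v) = scale N c (f v)) \<and>
     (\<forall>A\<in>sl2. \<forall>v\<in>carrier M. f (act M A v) = act N A (f v))"

definition sl2_short_exact ::
  "('a::field, 'u::ab_group_add) sl2_mod \<Rightarrow> ('u \<Rightarrow> 'v) \<Rightarrow>
   ('a, 'v::ab_group_add) sl2_mod \<Rightarrow> ('v \<Rightarrow> 'w) \<Rightarrow> ('a, 'w::ab_group_add) sl2_mod \<Rightarrow> bool" where
  "sl2_short_exact M f N g P \<longleftrightarrow>
     sl2_module M \<and> sl2_module N \<and> sl2_module P \<and>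
     sl2_hom M N f \<and> sl2_hom N P g \<and>
     inj_on f (carrier M) \<and>
     f ` carrier M = {v \<in> carrier N. g v = 0} \<and>
     g ` carrier N = carrier P"

text \<open>
  The simple highest weight module of highest weight \<open>l\<close> is unique up to isomorphism; it is
  represented by the property that pins it down.
\<close>

definition simple_highest_weight :: "'a::field \<Rightarrow> ('a, 'v::ab_group_add) sl2_mod \<Rightarrow> bool" where
  "simple_highest_weight l M \<longleftrightarrow>
     sl2_simple M \<and>
     (\<exists>v\<in>carrier M. v \<noteq> 0 \<and> act M sl2_x v = 0 \<and> act M sl2_h v = scale M l v)"

definition poly_integral :: "'a::field_char_0 poly \<Rightarrow> 'a poly" where
  "poly_integral p = (\<Sum>n\<le>degree p. monom (coeff p n / of_nat (Suc n)) (Suc n))"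

lemma coeff_poly_integral:
  "coeff (poly_integral p) n = (case n of 0 \<Rightarrow> 0 | Suc k \<Rightarrow> coeff p k / of_nat (Suc k))"
  by (cases n) (auto simp: poly_integral_def coeff_sum coeff_monom coeff_eq_0 
      if_distrib sum.delta cong: if_cong simp del: of_nat_Suc)

lemma pderiv_poly_integral: "pderiv (poly_integral p) = p"
  by (rule poly_eqI) (simp add: coeff_pderiv coeff_poly_integral del: of_nat_Suc)

text \<open>The division below is exact, since \<open>poly_integral\<close> has zero constant term.\<close>

definition q_poly :: "'a::field_char_0 poly \<Rightarrow> 'a poly" where
  "q_poly p = - (poly_integral (p * pderiv p + [:0, 1:] * pderiv (pderiv p)) div [:0, 2:])"

lemma q_poly_eq:
  "[:0, 2:] * q_poly p = - poly_integral (p * pderiv p + [:0, 1:] * pderiv (pderiv p))"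
  (is "_ = - ?I")
proof -
  have "poly ?I 0 = 0" by (simp add: poly_0_coeff_0 coeff_poly_integral)
  then have "[:0, 1:] dvd ?I" by (simp add: poly_eq_0_iff_dvd)
  then obtain k where "?I = [:0, 1:] * k" by (auto elim: dvdE)
  then have "?I = [:0, 2:] * smult (1/2) k" by simp
  then have "[:0, 2:] dvd ?I" by (rule dvdI)
  then show ?thesis unfolding q_poly_def by (simp only: mult_minus_right dvd_mult_div_cancel)
qed

definition V_x :: "'a::field_char_0 poly \<Rightarrow> 'a poly" where
  "V_x f = [:0, 1:] * f"

definition V_h :: "'a::field_char_0 poly \<Rightarrow> 'a poly \<Rightarrow> 'a poly" where
  "V_h p f = p * f + [:0, 2:] * pderiv f"

definition V_y :: "'a::field_char_0 poly \<Rightarrow> 'a poly \<Rightarrow> 'a poly" where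
  "V_y p f = q_poly p * f - p * pderiv f - [:0, 1:] * pderiv (pderiv f)"

definition V :: "'a::field_char_0 poly \<Rightarrow> ('a, 'a poly) sl2_mod" where
  "V p = \<lparr>carrier = UNIV, scale = smult,
     act = (\<lambda>A f. smult (A $ 1 $ 1) (V_h p f) + smult (A $ 1 $ 2) (V_x f)
                 + smult (A $ 2 $ 1) (V_y p f))\<rparr>"

lemma V_act_basis:
  "act (V p) sl2_x f = V_x f" "act (V p) sl2_h f = V_h p f" "act (V p) sl2_y f = V_y p f"
  by (simp_all add: V_def sl2_basis_defs)

lemma q_poly_deriv:
  "2 * q_poly p + [:0, 2:] * pderiv (q_poly p) = - (p * pderiv p + [:0, 1:] * pderiv (pderiv p))"
proof -
  have "pderiv ([:0, 2:] * q_poly p) = - (p * pderiv p + [:0, 1:] * pderiv (pderiv p))"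
    by (simp only: q_poly_eq pderiv_minus pderiv_poly_integral)
  moreover have "pderiv [:0, 2::'a:] = 2" by (simp add: pderiv_pCons numeral_poly)
  ultimately show ?thesis by (simp only: pderiv_mult) (simp add: algebra_simps)
qed

lemma V_brackets:
  "V_h p (V_x f) - V_x (V_h p f) = smult 2 (V_x f)"
  "V_h p (V_y p f) - V_y p (V_h p f) = smult (-2) (V_y p f)"
  "V_x (V_y p f) - V_y p (V_x f) = V_h p f"
proof -
  define X :: "'a poly" where "X = [:0, 1:]"
  have dX: "pderiv X = 1" by (simp add: X_def pderiv_pCons)
  have X2: "[:0, 2:] = 2 * X" by (simp add: X_def numeral_poly)
  have d2: "pderiv (2 :: 'a poly) = 0" by (simp add: numeral_poly pderiv_pCons)
  have s2: "smult 2 g = 2 * g" "smult (-2) g = - 2 * g" for g :: "'a poly"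
    by (simp_all add: numeral_poly)
  note defs = V_x_def V_h_def V_y_def X_def[symmetric] X2 s2
  note d = pderiv_mult pderiv_add pderiv_diff pderiv_minus dX d2 pderiv_1
  have q: "2 * q_poly p + 2 * X * pderiv (q_poly p) = - (p * pderiv p + X * pderiv (pderiv p))"
    using q_poly_deriv[of p] by (simp only: X2 X_def[symmetric])
  show "V_h p (V_x f) - V_x (V_h p f) = smult 2 (V_x f)"
    unfolding defs d by (simp add: algebra_simps)
  show "V_x (V_y p f) - V_y p (V_x f) = V_h p f"
    unfolding defs d by (simp add: algebra_simps)
  have "V_h p (V_y p f) - V_y p (V_h p f) + 2 * V_y p f
      = (2 * q_poly p + 2 * X * pderiv (q_poly p) + (p * pderiv p + X * pderiv (pderiv p))) * f"
    unfolding defs d by (simp add: algebra_simps)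
  also have "\<dots> = 0" by (simp add: q)
  finally show "V_h p (V_y p f) - V_y p (V_h p f) = smult (-2) (V_y p f)"
    unfolding s2 by (simp add: eq_neg_iff_add_eq_0)
qed

lemma V_linear:
  "V_x (f + g) = V_x f + V_x g" "V_x (smult c f) = smult c (V_x f)"
  "V_h p (f + g) = V_h p f + V_h p g" "V_h p (smult c f) = smult c (V_h p f)"
  "V_y p (f + g) = V_y p f + V_y p g" "V_y p (smult c f) = smult c (V_y p f)"
  by (simp_all add: V_x_def V_h_def V_y_def pderiv_add pderiv_smult algebra_simps smult_add_right
      smult_diff_right)

lemma sl2_module_V: "sl2_module (V p)"
proof -
  have vs: "vector_space (smult :: 'a \<Rightarrow> 'a poly \<Rightarrow> 'a poly)"
    by unfold_locales (simp_all add: smult_add_right smult_add_left)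
  then have m: "Modules.module (smult :: 'a \<Rightarrow> 'a poly \<Rightarrow> 'a poly)"
    by (simp add: vector_space_def Modules.module_def)
  have br: "act (V p) (bracket A B) f = act (V p) A (act (V p) B f) - act (V p) B (act (V p) A f)"
    if "A \<in> sl2" "B \<in> sl2" for A B f
  proof -
    define a b c where "a = A $ 1 $ 1" and "b = A $ 1 $ 2" and "c = A $ 2 $ 1"
    define a' b' c' where "a' = B $ 1 $ 1" and "b' = B $ 1 $ 2" and "c' = B $ 2 $ 1"
    have "A $ 2 $ 2 = - a" "B $ 2 $ 2 = - a'"
      using that by (simp_all add: sl2_def trace_def sum_2 a_def a'_def eq_neg_iff_add_eq_0 add.commute)
    then have C: "bracket A B $ 1 $ 1 = b * c' - b' * c"
      "bracket A B $ 1 $ 2 = 2 * (a * b' - a' * b)"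
      "bracket A B $ 2 $ 1 = -2 * (a * c' - a' * c)"
      by (simp_all add: bracket_def matrix_matrix_mult_def sum_2 a_def b_def c_def
          a'_def b'_def c'_def algebra_simps)
    have "act (V p) A (act (V p) B f) - act (V p) B (act (V p) A f)
      = smult (b * c' - b' * c) (V_x (V_y p f) - V_y p (V_x f))
      + smult (a * b' - a' * b) (V_h p (V_x f) - V_x (V_h p f))
      + smult (a * c' - a' * c) (V_h p (V_y p f) - V_y p (V_h p f))"
      unfolding V_def a_def b_def c_def a'_def b'_def c'_def
      by (simp add: V_linear algebra_simps smult_add_right smult_add_left smult_diff_right smult_diff_left)
    also have "\<dots> = act (V p) (bracket A B) f"
      unfolding V_brackets
      by (simp add: V_def C algebra_simps flip: smult_add_left)
    finally show ?thesis ..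
  qed
  have sub: "module.subspace (scale (V p)) (carrier (V p))"
    using Modules.module.subspace_UNIV[OF m] by (simp add: V_def)
  show ?thesis
    unfolding sl2_module_def
    using vs sub br
    by (simp add: V_def V_linear scale_mat_def smult_add_right smult_add_left
        algebra_simps)
qed

end

theory Submission imports Defs
begin

text \<open>
  Since \<open>x\<close> acts by multiplication, every submodule of \<open>V p\<close> is an ideal \<open>(g)\<close> of the
  polynomial ring.  Stability under \<open>h\<close> means that \<open>g\<close> divides \<open>x g'\<close>, which forces \<open>g\<close> to be a
  monomial \<open>x\<^sup>k\<close>, and stability under \<open>y\<close> then means that \<open>k (p(0) + k - 1) = 0\<close>.  So the only
  possible proper nonzero submodule is \<open>(x\<^sup>k)\<close> with \<open>p(0) = 1 - k\<close>.  Multiplication by \<open>x\<^sup>k\<close>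
  identifies it with \<open>V (p + 2k)\<close>, and in the quotient by it, which is realised by the remainders
  modulo \<open>x\<^sup>k\<close>, the class of \<open>x\<^sup>k\<^sup>-\<^sup>1\<close> is a highest weight vector of weight \<open>k - 1\<close>.
\<close>

section \<open>Homomorphic images and preimages\<close>

text \<open>Each module axiom of \<open>N\<close> at \<open>g v\<close> is the image under
  \<open>g\<close> of the same axiom of \<open>M\<close> at \<open>v\<close>. This gives the module
  structure on the quotient without checking the axioms there. That \<open>scale N\<close> is a
  vector space structure is assumed separately, since it concerns the whole ambient type.\<close>

lemma sl2_module_hom_image:
  assumes M: "sl2_module M" and vs: "vector_space (scale N)"
    and hom: "sl2_hom M N g" and im: "g ` carrier M = carrier N"
  shows "sl2_module N"
proof -
  interpret M: vector_space "scale M" using M by (simp add: sl2_module_def)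
  interpret N: vector_space "scale N" by (rule vs)
  have subM: "M.subspace (carrier M)" using M by (simp add: sl2_module_def)
  note sub = M.subspace_add[OF subM] M.subspace_scale[OF subM] M.subspace_diff[OF subM]
    M.subspace_0[OF subM]
  have add: "g (v + w) = g v + g w" if "v \<in> carrier M" "w \<in> carrier M" for v w
    using hom that by (simp add: sl2_hom_def)
  have diff: "g (v - w) = g v - g w" if "v \<in> carrier M" "w \<in> carrier M" for v w
    using add[of "v - w" w] that sub by (simp add: algebra_simps)
  have scale: "g (scale M c v) = scale N c (g v)" if "v \<in> carrier M" for c v
    using hom that by (simp add: sl2_hom_def)
  have act: "act N A (g v) = g (act M A v)" if "A \<in> sl2" "v \<in> carrier M" for A v
    using hom that by (simp add: sl2_hom_def)
  have actM: "act M A v \<in> carrier M" if "A \<in> sl2" "v \<in> carrier M" for A v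
    using M that by (simp add: sl2_module_def)
  have cl: "A + B \<in> sl2" "bracket A B \<in> sl2" if "A \<in> sl2" "B \<in> sl2" for A B :: "'a^2^2"
    using that trace_mul_sym[of A B] by (simp_all add: sl2_def trace_add trace_sub bracket_def)
  have cl': "scale_mat c A \<in> sl2" if "A \<in> sl2" for A :: "'a^2^2" and c
    using that by (simp add: sl2_def trace_def scale_mat_def flip: sum_distrib_left)
  have "N.subspace (carrier N)"
  proof (rule N.subspaceI)
    have "g 0 = 0" using diff[of 0 0] sub(4) by simp
    then show "0 \<in> carrier N" using sub(4) im by force
  next
    fix v w assume "v \<in> carrier N" "w \<in> carrier N"
    then obtain v' w' where "v' \<in> carrier M" "w' \<in> carrier M" "v = g v'" "w = g w'"
      using im by blast
    then show "v + w \<in> carrier N" using add sub(1) im by (metis image_eqI)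
  next
    fix c v assume "v \<in> carrier N"
    then obtain v' where "v' \<in> carrier M" "v = g v'" using im by blast
    then show "scale N c v \<in> carrier N" using scale sub(2) im by (metis image_eqI)
  qed
  then show ?thesis
    unfolding sl2_module_def im[symmetric]
  proof (intro conjI ballI allI vs; (elim imageE)?; hypsubst?)
    fix A B :: "'a^2^2" and c v w
    assume AB: "A \<in> sl2" "B \<in> sl2" and vw: "v \<in> carrier M" "w \<in> carrier M"
    \<comment> \<open>The equations are oriented so that \<open>g\<close> moves outwards; each goal
      becomes \<open>g\<close> applied to an axiom of \<open>M\<close>.\<close>
    note f = AB vw act actM cl cl' sub add[symmetric] diff[symmetric] scale[symmetric]
    have Ma: "act M A (v + w) = act M A v + act M A w"
      "act M A (scale M c v) = scale M c (act M A v)"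
      "act M (A + B) v = act M A v + act M B v"
      "act M (scale_mat c A) v = scale M c (act M A v)"
      "act M (bracket A B) v = act M A (act M B v) - act M B (act M A v)"
      using M AB vw by (simp_all add: sl2_module_def)
    show "act N A (g v) \<in> g ` carrier M" by (simp add: f)
    show "act N A (g v + g w) = act N A (g v) + act N A (g w)" by (simp add: f Ma)
    show "act N A (scale N c (g v)) = scale N c (act N A (g v))" by (simp add: f Ma)
    show "act N (A + B) (g v) = act N A (g v) + act N B (g v)" by (simp add: f Ma)
    show "act N (scale_mat c A) (g v) = scale N c (act N A (g v))" by (simp add: f Ma)
    show "act N (bracket A B) (g v) = act N A (act N B (g v)) - act N B (act N A (g v))"
      by (simp add: f Ma)
  qed
qed

text \<open>Pulls submodules of the quotient back to \<open>V p\<close>, whose submodules are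
  classified below.\<close>

lemma sl2_submodule_vimage:
  assumes M: "sl2_module M" and N: "vector_space (scale N)"
    and hom: "sl2_hom M N g" and U: "sl2_submodule U N"
  shows "sl2_submodule {v \<in> carrier M. g v \<in> U} M"
proof -
  interpret M: vector_space "scale M" using M by (simp add: sl2_module_def)
  interpret N: vector_space "scale N" by (rule N)
  have subM: "M.subspace (carrier M)" using M by (simp add: sl2_module_def)
  have subU: "N.subspace U" using U by (simp add: sl2_submodule_def)
  note sub = M.subspace_add[OF subM] M.subspace_scale[OF subM] M.subspace_0[OF subM]
  note subu = N.subspace_add[OF subU] N.subspace_scale[OF subU] N.subspace_0[OF subU]
  have "g (0 + 0) = g 0 + g 0" using hom sub(3) unfolding sl2_hom_def by blast
  then have g0: "g 0 = 0" by simp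
  have "M.subspace {v \<in> carrier M. g v \<in> U}"
    by (rule M.subspaceI) (use hom sub subu g0 in \<open>auto simp: sl2_hom_def\<close>)
  then show ?thesis
    using M hom U by (auto simp: sl2_submodule_def sl2_module_def sl2_hom_def)
qed

section \<open>Submodules of \<open>V p\<close>\<close>

lemma vector_space_smult: "vector_space (smult :: 'a::field \<Rightarrow> 'a poly \<Rightarrow> 'a poly)"
  by unfold_locales (simp_all add: smult_add_right smult_add_left)

lemma V_simps:
  "carrier (V p) = UNIV" "scale (V p) = smult"
  "act (V p) A f = smult (A $ 1 $ 1) (V_h p f) + smult (A $ 1 $ 2) (V_x f) + smult (A $ 2 $ 1) (V_y p f)"
  by (simp_all add: V_def)

text \<open>Three operators suffice because every matrix acts as a linear combination of
  them.\<close>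

lemma sl2_submodule_V_iff:
  "sl2_submodule N (V p) \<longleftrightarrow>
     0 \<in> N \<and> (\<forall>f\<in>N. \<forall>g\<in>N. f + g \<in> N) \<and> (\<forall>c. \<forall>f\<in>N. smult c f \<in> N) \<and>
     (\<forall>f\<in>N. V_x f \<in> N \<and> V_h p f \<in> N \<and> V_y p f \<in> N)" (is "?L \<longleftrightarrow> ?R")
proof -
  interpret vector_space "smult :: 'a \<Rightarrow> 'a poly \<Rightarrow> 'a poly" by (rule vector_space_smult)
  have sub: "module.subspace (scale (V p)) N \<longleftrightarrow>
      0 \<in> N \<and> (\<forall>f\<in>N. \<forall>g\<in>N. f + g \<in> N) \<and> (\<forall>c. \<forall>f\<in>N. smult c f \<in> N)"
    by (simp add: V_simps subspace_def)
  show ?thesis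
  proof
    assume L: ?L
    then have act: "act (V p) A f \<in> N" if "A \<in> sl2" "f \<in> N" for A f
      using that by (simp add: sl2_submodule_def)
    show ?R
      using L sub act[OF sl2_basis_mem(1)] act[OF sl2_basis_mem(2)] act[OF sl2_basis_mem(3)]
      by (auto simp: sl2_submodule_def V_act_basis)
  next
    assume R: ?R
    have "act (V p) A f \<in> N" if "f \<in> N" for A f
      using R that by (simp add: V_simps)
    then show ?L using R sub by (simp add: sl2_submodule_def V_simps(1))
  qed
qed

section \<open>Ideals of the polynomial ring and their generators\<close>

lemma V_x_stable_imp_ideal:
  assumes "0 \<in> N" "\<And>f g. f \<in> N \<Longrightarrow> g \<in> N \<Longrightarrow> f + g \<in> N" "\<And>c f. f \<in> N \<Longrightarrow> smult c f \<in> N"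
    and "\<And>f. f \<in> N \<Longrightarrow> V_x f \<in> N" and "g \<in> N"
  shows "f * g \<in> N"
proof (induction f)
  case 0
  then show ?case using assms by simp
next
  case (pCons c f)
  \<comment> \<open>The Horner form \<open>c + x f\<close> builds every multiple of \<open>g\<close>
    from scalar multiples, sums and the action of \<open>x\<close>.\<close>
  have "pCons c f * g = smult c g + V_x (f * g)" by (simp add: V_x_def)
  then show ?case using assms pCons by simp
qed

text \<open>A nonzero element of least degree generates \<open>N\<close>: the remainder of any
  \<open>f\<close> in \<open>N\<close> modulo it is again in \<open>N\<close> and has smaller
  degree, so it vanishes.\<close>

lemma poly_ideal_principal:
  fixes N :: "'a::field poly set"
  assumes "0 \<in> N" and add: "\<And>f g. f \<in> N \<Longrightarrow> g \<in> N \<Longrightarrow> f + g \<in> N"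
    and mult: "\<And>f g. g \<in> N \<Longrightarrow> f * g \<in> N" and ne: "N \<noteq> {0}"
  obtains g where "g \<noteq> 0" "N = {f. g dvd f}"
proof -
  from \<open>0 \<in> N\<close> ne have "\<exists>g. g \<in> N \<and> g \<noteq> 0" by auto
  then obtain g where g: "g \<in> N" "g \<noteq> 0"
    and min: "\<And>f. f \<in> N \<Longrightarrow> f \<noteq> 0 \<Longrightarrow> degree g \<le> degree f"
    using ex_has_least_nat[of "\<lambda>g. g \<in> N \<and> g \<noteq> 0" _ degree] by blast
  have "g dvd f" if f: "f \<in> N" for f
  proof (rule ccontr)
    assume "\<not> g dvd f"
    then have nz: "f mod g \<noteq> 0" by (simp add: dvd_eq_mod_eq_0)
    have "f mod g = f + (- (f div g)) * g" by (simp add: minus_div_mult_eq_mod [symmetric])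
    then have "f mod g \<in> N" using add[OF f mult[OF g(1), of "- (f div g)"]] by simp
    then show False using min[of "f mod g"] degree_mod_less[OF g(2), of f] nz by auto
  qed
  with g mult have "N = {f. g dvd f}" by (auto elim!: dvdE simp: mult.commute)
  with g(2) show thesis by (rule that)
qed

text \<open>As \<open>x g'\<close> has degree at most that of \<open>g\<close>, the cofactor is a
  constant \<open>c\<close>. Comparing coefficients gives \<open>n a_n = c a_n\<close> for all
  \<open>n\<close>, and in characteristic zero only one \<open>a_n\<close> can be nonzero.\<close>

lemma dvd_x_pderiv_imp_monom:
  fixes g :: "'a::field_char_0 poly"
  assumes "g \<noteq> 0" "g dvd [:0, 1:] * pderiv g"
  shows "g = monom (lead_coeff g) (degree g)"
proof -
  obtain h where h: "[:0, 1:] * pderiv g = g * h" using assms(2) by (elim dvdE)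
  have "degree h = 0"
  proof (cases "h = 0")
    case False
    with assms(1) h have "pderiv g \<noteq> 0" by auto
    have "degree g + degree h = degree ([:0, 1:] * pderiv g)"
      using degree_mult_eq[OF assms(1) False] h by metis
    also have "\<dots> = Suc (degree g - 1)"
      using \<open>pderiv g \<noteq> 0\<close> by (simp add: degree_pderiv)
    \<comment> \<open>A nonzero derivative forces \<open>degree g > 0\<close>, so the truncated
      subtraction is exact.\<close>
    also have "\<dots> = degree g"
      using \<open>pderiv g \<noteq> 0\<close> by (simp add: pderiv_eq_0_iff)
    finally show ?thesis by simp
  qed simp
  then obtain c where c: "h = [:c:]" by (rule degree_eq_zeroE)
  have co: "of_nat n * coeff g n = c * coeff g n" for n
    using arg_cong[OF h, of "\<lambda>f. coeff f n"]
    by (cases n) (simp_all add: c coeff_pderiv)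
  have "of_nat (degree g) = c" using co[of "degree g"] assms(1) by simp
  then have "coeff g n = 0" if "n \<noteq> degree g" for n
    using co[of n] that by auto
  then show ?thesis by (intro poly_eqI) auto
qed

section \<open>The action on multiples of a monomial\<close>

text \<open>The factor \<open>x\<close> on both sides avoids the exponent \<open>k - 1\<close>, which is truncated at \<open>k = 0\<close>.\<close>

lemma x_pderiv_monom: "[:0, 1:] * pderiv (monom 1 k) = of_nat k * monom (1 :: 'a::field_char_0) k"
  by (cases k) (simp_all add: pderiv_monom of_nat_poly smult_monom flip: monom_Suc)

text \<open>The product rule with \<open>x m' = k m\<close> and \<open>x^2 m'' = k (k - 1) m\<close>
  for \<open>m = x^k\<close>. The term \<open>k (p + k - 1)\<close> is the obstruction to cancelling
  the factor \<open>x\<close> on both sides.\<close>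

lemma V_y_monom_mult:
  "[:0, 1:] * V_y p (monom 1 k * f) =
     monom 1 k * (([:0, 1:] * q_poly p - of_nat k * (p + of_nat k - 1)) * f
       - (p + 2 * of_nat k) * [:0, 1:] * pderiv f - [:0, 1:]\<^sup>2 * pderiv (pderiv f))"
proof -
  define X :: "'a poly" where "X = [:0, 1:]"
  define m where "m = monom (1 :: 'a) k"
  define K :: "'a poly" where "K = of_nat k"
  have dK: "pderiv K = 0" by (simp add: K_def)
  have dX: "pderiv X = 1" by (simp add: X_def pderiv_pCons)
  have 1: "X * pderiv m = K * m"
    by (simp only: X_def m_def K_def x_pderiv_monom)
  \<comment> \<open>Differentiating the first relation controls \<open>m''\<close> without
    mentioning the exponents \<open>k - 1\<close> and \<open>k - 2\<close>.\<close>
  have 2: "pderiv m + X * pderiv (pderiv m) = K * pderiv m"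
    using arg_cong[OF 1, of pderiv] by (simp add: pderiv_mult dX dK algebra_simps)
  show ?thesis
    unfolding V_y_def X_def[symmetric] m_def[symmetric] K_def[symmetric] pderiv_mult pderiv_add
    using 1 2 by algebra
qed

text \<open>A closed form for the integral: \<open>p p' + x p''\<close> is the derivative of
  \<open>p^2/2 + x p' - p\<close>, and the constant is fixed by the value at 0.\<close>

lemma four_x_q_poly:
  "4 * [:0, 1:] * q_poly p = [:(poly p 0)\<^sup>2 - 2 * poly p 0:] - (p\<^sup>2 + 2 * [:0, 1:] * pderiv p - 2 * p)"
proof -
  define X :: "'a poly" where "X = [:0, 1:]"
  define D where "D = 4 * X * q_poly p + (p\<^sup>2 + 2 * X * pderiv p - 2 * p)"
  have dX: "pderiv X = 1" by (simp add: X_def pderiv_pCons)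
  have X2: "[:0, 2:] = 2 * X" by (simp add: X_def numeral_poly)
  have "pderiv D = 2 * (2 * q_poly p + 2 * X * pderiv (q_poly p) + (p * pderiv p + X * pderiv (pderiv p)))"
    by (simp add: D_def pderiv_mult pderiv_add pderiv_diff power2_eq_square dX algebra_simps)
  also have "\<dots> = 0" using q_poly_deriv[of p] by (simp only: X2 X_def[symmetric]) simp
  finally have "degree D = 0" by (simp add: pderiv_eq_0_iff)
  then obtain c where c: "D = [:c:]" by (rule degree_eq_zeroE)
  have "poly D 0 = (poly p 0)\<^sup>2 - 2 * poly p 0" by (simp add: D_def X_def)
  with c have "D = [:(poly p 0)\<^sup>2 - 2 * poly p 0:]" by simp
  then show ?thesis unfolding D_def X_def by (simp add: algebra_simps)
qed

text \<open>The constant terms \<open>1 - k\<close> of \<open>p\<close> and \<open>1 + k\<close> of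
  \<open>r = p + 2k\<close> give the same value of \<open>c^2 - 2c\<close>. Hence the closed forms
  of \<open>4 x q\<close> for \<open>p\<close> and \<open>r\<close> differ exactly by
  \<open>4 k (p + k - 1)\<close>, which absorbs the obstruction term.\<close>

lemma V_y_monom_mult_shift:
  assumes "poly p 0 = 1 - of_nat k"
  shows "V_y p (monom 1 k * f) = monom 1 k * V_y (p + of_nat (2 * k)) f"
proof -
  define X :: "'a poly" where "X = [:0, 1:]"
  define K :: "'a poly" where "K = of_nat k"
  let ?r = "p + 2 * K"
  have X0: "4 * X \<noteq> 0" by (simp add: X_def)
  have dK: "pderiv K = 0" by (simp add: K_def)
  have c: "[:(1 - of_nat k)\<^sup>2 - 2 * (1 - of_nat k):] = (1 - K)\<^sup>2 - 2 * (1 - K)"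
    "[:(1 + of_nat k)\<^sup>2 - 2 * (1 + of_nat k):] = (1 + K)\<^sup>2 - 2 * (1 + K)"
    by (simp_all add: K_def of_nat_poly numeral_poly power2_eq_square one_pCons)
  have p0: "poly ?r 0 = 1 + of_nat k" by (simp add: assms K_def)
  have q: "4 * X * q_poly p = (1 - K)\<^sup>2 - 2 * (1 - K) - (p\<^sup>2 + 2 * X * pderiv p - 2 * p)"
    using four_x_q_poly[of p] unfolding assms c X_def[symmetric] .
  have dr: "pderiv ?r = pderiv p" by (simp add: pderiv_add pderiv_mult dK)
  have q': "4 * X * q_poly ?r = (1 + K)\<^sup>2 - 2 * (1 + K) - (?r\<^sup>2 + 2 * X * pderiv p - 2 * ?r)"
    using four_x_q_poly[of ?r] unfolding p0 c X_def[symmetric] dr .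
  have "4 * X * V_y p (monom 1 k * f) = 4 * X * (monom 1 k * V_y ?r f)"
    using V_y_monom_mult[of p k f] q q'
    unfolding V_y_def[of ?r] X_def[symmetric] K_def[symmetric] by algebra
  then show ?thesis using X0 by (simp add: K_def)
qed


lemma V_h_monom_mult:
  "V_h p (monom 1 k * f) = monom 1 k * V_h (p + of_nat (2 * k)) f"
proof -
  define X :: "'a poly" where "X = [:0, 1:]"
  have X2: "[:0, 2:] = 2 * X" by (simp add: X_def numeral_poly)
  show ?thesis
    using x_pderiv_monom[of k, where 'a = 'a]
    unfolding V_h_def X2 X_def[symmetric] pderiv_mult of_nat_mult of_nat_numeral by algebra
qed

lemma V_x_monom_mult: "V_x (monom 1 k * f) = monom 1 k * V_x f"
  unfolding V_x_def by algebra

lemma sl2_hom_monom_mult: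
  assumes "poly p 0 = 1 - of_nat k"
  shows "sl2_hom (V (p + of_nat (2 * k))) (V p) (\<lambda>f. monom 1 k * f)"
  unfolding sl2_hom_def V_simps V_x_monom_mult V_h_monom_mult V_y_monom_mult_shift[OF assms]
  by (simp add: distrib_left)

lemma sl2_submodule_monom_ideal:
  fixes p :: "'a::field_char_0 poly"
  assumes "poly p 0 = 1 - of_nat k"
  shows "sl2_submodule {f. monom 1 k dvd f} (V p)"
  unfolding sl2_submodule_V_iff
proof (intro conjI ballI allI)
  fix f :: "'a poly" assume "f \<in> {f. monom 1 k dvd f}"
  then obtain g where f: "f = monom 1 k * g" by (auto elim: dvdE)
  show "V_x f \<in> {f. monom 1 k dvd f}" "V_h p f \<in> {f. monom 1 k dvd f}"
    "V_y p f \<in> {f. monom 1 k dvd f}"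
    by (simp_all add: f V_x_monom_mult V_h_monom_mult V_y_monom_mult_shift[OF assms])
qed (auto intro: dvd_smult)

section \<open>Classification of the submodules\<close>

lemma sl2_submodule_V_cases:
  fixes p :: "'a::field_char_0 poly"
  assumes "sl2_submodule N (V p)" "N \<noteq> {0}" "N \<noteq> UNIV"
  obtains k where "k > 0" "poly p 0 = 1 - of_nat k" "N = {f. monom 1 k dvd f}"
proof -
  have N: "0 \<in> N" "\<And>f g. f \<in> N \<Longrightarrow> g \<in> N \<Longrightarrow> f + g \<in> N" "\<And>c f. f \<in> N \<Longrightarrow> smult c f \<in> N"
    "\<And>f. f \<in> N \<Longrightarrow> V_x f \<in> N" and hy: "\<And>f. f \<in> N \<Longrightarrow> V_h p f \<in> N" "\<And>f. f \<in> N \<Longrightarrow> V_y p f \<in> N"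
    using assms(1) by (auto simp: sl2_submodule_V_iff)
  have mult: "f * g \<in> N" if "g \<in> N" for f g
    using V_x_stable_imp_ideal[OF N that] .
  obtain g where g: "g \<noteq> 0" "N = {f. g dvd f}"
    using poly_ideal_principal[OF N(1,2) mult assms(2)] by blast
  define k where "k = degree g"
  define m where "m = monom (1 :: 'a) k"
  have "g dvd p * g + [:0, 2:] * pderiv g"
    using hy(1)[of g] g(2) by (simp add: V_h_def)
  then have "g dvd [:0, 2:] * pderiv g" by (simp only: dvd_add_right_iff[OF dvd_triv_right])
  moreover have "[:0, 2:] * pderiv g = smult 2 ([:0, 1:] * pderiv g)" by simp
  ultimately have "g dvd [:0, 1:] * pderiv g" by (metis dvd_smult_cancel zero_neq_numeral)
  \<comment> \<open>The generator is a nonzero scalar times \<open>x^k\<close>, so both generate the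
    same ideal.\<close>
  then have "g = smult (lead_coeff g) m"
    using dvd_x_pderiv_imp_monom[OF g(1)] by (simp add: smult_monom m_def k_def)
  then have "g dvd f \<longleftrightarrow> m dvd f" for f
    using g(1) by (metis leading_coeff_0_iff smult_dvd_iff)
  then have Nm: "N = {f. m dvd f}" using g(2) by simp
  have "k \<noteq> 0" using assms(3) Nm by (auto simp: m_def)
  have "m dvd V_y p m" using hy(2)[of m] Nm by simp
  then obtain r where "V_y p m = m * r" by (rule dvdE)
  \<comment> \<open>The monomial formula at \<open>f = 1\<close>, where the derivative terms drop
    out.\<close>
  then have "m * ([:0, 1:] * r) = m * ([:0, 1:] * q_poly p - of_nat k * (p + of_nat k - 1))"
    using V_y_monom_mult[of p k 1] by (simp add: m_def mult.left_commute)
  moreover have "m \<noteq> 0" by (simp add: m_def)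
  ultimately have "[:0, 1:] * r = [:0, 1:] * q_poly p - of_nat k * (p + of_nat k - 1)"
    by (simp only: mult_cancel_left) simp
  \<comment> \<open>At 0 all terms with a factor \<open>x\<close> vanish and only the obstruction is
    left.\<close>
  from arg_cong[OF this, of "\<lambda>f. poly f 0"]
  have "of_nat k * (poly p 0 + of_nat k - 1) = 0" by simp
  with \<open>k \<noteq> 0\<close> have "poly p 0 + of_nat k - 1 = 0" by (simp only: mult_eq_0_iff of_nat_eq_0_iff) simp
  then have "poly p 0 = 1 - of_nat k" by (simp add: algebra_simps)
  with \<open>k \<noteq> 0\<close> Nm show thesis by (intro that[of k]) (auto simp: m_def)
qed

section \<open>The quotient\<close>

text \<open>Choosing remainders as representatives keeps the quotient inside the polynomial type,
  with the same scalar multiplication.\<close>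

definition V_quot :: "'a::field_char_0 poly \<Rightarrow> nat \<Rightarrow> ('a, 'a poly) sl2_mod" where
  "V_quot p k = \<lparr>carrier = range (\<lambda>f. f mod monom 1 k), scale = smult,
     act = (\<lambda>A f. act (V p) A f mod monom 1 k)\<rparr>"

text \<open>\<open>f\<close> and its remainder differ by an element of the submodule
  \<open>(x^k)\<close>, so acting before or after reduction gives the same class.\<close>

lemma sl2_hom_V_quot:
  assumes "poly p 0 = 1 - of_nat k"
  shows "sl2_hom (V p) (V_quot p k) (\<lambda>f. f mod monom 1 k)"
proof -
  have act: "act (V p) A f mod monom 1 k = act (V p) A (f mod monom 1 k) mod monom 1 k"
    if "A \<in> sl2" for A f
  proof -
    let ?m = "monom (1 :: 'a) k"
    have "?m dvd act (V p) A (f - f mod ?m)"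
      using sl2_submodule_monom_ideal[OF assms] that
      by (simp add: sl2_submodule_def V_simps(1) minus_mod_eq_mult_div)
    moreover have "act (V p) A f = act (V p) A (f mod ?m) + act (V p) A (f - f mod ?m)"
    proof -
      have "act (V p) A (g + h) = act (V p) A g + act (V p) A h" for g h
        by (simp add: V_simps(3) V_linear smult_add_right)
      from this[of "f mod ?m" "f - f mod ?m"] show ?thesis by simp
    qed
    ultimately show ?thesis by (auto elim!: dvdE)
  qed
  show ?thesis
    by (simp add: sl2_hom_def V_simps(1,2) V_quot_def poly_mod_add_left mod_smult_left act[symmetric])
qed

lemma sl2_short_exact_V:
  assumes "poly p 0 = 1 - of_nat k"
  shows "sl2_short_exact (V (p + of_nat (2 * k))) (\<lambda>f. monom 1 k * f) (V p)
    (\<lambda>f. f mod monom 1 k) (V_quot p k)"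
proof -
  have "sl2_module (V_quot p k)"
    by (rule sl2_module_hom_image[OF sl2_module_V _ sl2_hom_V_quot[OF assms]])
      (simp_all add: V_quot_def V_simps vector_space_smult)
  moreover have "inj_on (\<lambda>f. monom (1 :: 'a) k * f) UNIV" by (auto intro!: inj_onI)
  moreover have "range (\<lambda>f. monom 1 k * f) = {f. monom (1 :: 'a) k dvd f}" by (auto simp: dvd_def)
  ultimately show ?thesis
    unfolding sl2_short_exact_def
    by (simp add: sl2_module_V sl2_hom_monom_mult[OF assms] sl2_hom_V_quot[OF assms]
        del: of_nat_mult)
      (simp add: V_simps V_quot_def mod_eq_0_iff_dvd)
qed

lemma V_submodule_trichotomy:
  assumes "poly p 0 = 1 - of_nat k" "sl2_submodule N (V p)"
  shows "N = {0} \<or> N = {f. monom 1 k dvd f} \<or> N = UNIV"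
proof (cases "N = {0} \<or> N = UNIV")
  case False
  then obtain l where "poly p 0 = 1 - of_nat l" "N = {f. monom 1 l dvd f}"
    using sl2_submodule_V_cases[OF assms(2)] by blast
  \<comment> \<open>In characteristic zero \<open>p(0) = 1 - k\<close> determines
    \<open>k\<close>.\<close>
  with assms(1) show ?thesis by simp
qed auto

lemma simple_highest_weight_V_quot:
  assumes p: "poly p 0 = 1 - of_nat k" and k: "k > 0"
  shows "simple_highest_weight (- poly p 0) (V_quot p k)"
proof -
  let ?m = "monom (1 :: 'a) k"
  obtain n where n: "k = Suc n" using k by (cases k) auto
  define v where "v = monom (1 :: 'a) n"
  have v: "v mod ?m = v" by (simp add: v_def n mod_poly_less degree_monom_eq)
  have module: "sl2_module (V_quot p k)" using sl2_short_exact_V[OF p] by (simp add: sl2_short_exact_def)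
  have "v \<noteq> 0" by (simp add: v_def)
  have "v \<in> carrier (V_quot p k)" using v by (auto simp: V_quot_def intro: range_eqI[of v _ v])
  have N: "N = {0} \<or> N = carrier (V_quot p k)" if N: "sl2_submodule N (V_quot p k)" for N
  proof -
    \<comment> \<open>The preimage of \<open>N\<close> in \<open>V p\<close> is 0,
      \<open>(x^k)\<close> or everything; its image \<open>N\<close> is then 0, 0 or the whole
      quotient.\<close>
    define U where "U = {f. f mod ?m \<in> N}"
    have "N \<subseteq> carrier (V_quot p k)" using N by (simp add: sl2_submodule_def)
    moreover have "f mod ?m = f" if "f \<in> carrier (V_quot p k)" for f
      using that by (auto simp: V_quot_def)
    ultimately have "f \<in> U \<and> f mod ?m = f" if "f \<in> N" for f using that by (auto simp: U_def)
    then have img: "N = (\<lambda>f. f mod ?m) ` U" by (force simp: U_def)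
    have "sl2_submodule U (V p)"
      using sl2_submodule_vimage[OF sl2_module_V _ sl2_hom_V_quot[OF p] N]
      by (simp add: V_quot_def V_simps(1) vector_space_smult U_def)
    from V_submodule_trichotomy[OF p this]
    consider "U = {0}" | "U = {f. ?m dvd f}" | "U = UNIV" by blast
    then show ?thesis
    proof cases
      case 2
      then have "N \<subseteq> {0}" "0 \<in> N" using img by (auto simp: mod_eq_0_iff_dvd image_iff intro: exI[of _ 0])
      then show ?thesis by auto
    qed (simp_all add: img V_quot_def)
  qed
  have "act (V_quot p k) sl2_x v = 0"
    by (simp add: V_quot_def V_act_basis V_x_def v_def n flip: monom_Suc)
  moreover have "act (V_quot p k) sl2_h v = scale (V_quot p k) (- poly p 0) v"
  proof -
    obtain r where r: "p = pCons (poly p 0) r" by (cases p) auto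
    \<comment> \<open>\<open>h\<close> multiplies \<open>x^n\<close> by \<open>p + 2n\<close>, whose
      constant term is \<open>1 - k + 2n = n\<close> as \<open>k = n + 1\<close>; the higher terms
      land in \<open>(x^k)\<close>.\<close>
    have "V_h p v = v * (p + of_nat (2 * n))"
      using V_h_monom_mult[of p n 1] by (simp add: V_h_def v_def)
    also have "p + of_nat (2 * n) = [:of_nat n:] + [:0, 1:] * r"
      by (subst r) (simp add: p n of_nat_poly)
    also have "v * ([:of_nat n:] + [:0, 1:] * r) = smult (of_nat n) v + ?m * r"
      by (simp add: v_def n monom_Suc distrib_left)
    finally have "V_h p v mod ?m = smult (of_nat n) v mod ?m" by simp
    then show ?thesis using v by (simp add: V_quot_def V_act_basis mod_smult_left p n)
  qed
  ultimately show ?thesis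
    unfolding simple_highest_weight_def sl2_simple_def
    using module N \<open>v \<noteq> 0\<close> \<open>v \<in> carrier _\<close> by blast
qed

section \<open>Simplicity and length\<close>

lemma sl2_simple_V_iff: "sl2_simple (V p) \<longleftrightarrow> poly p 0 \<notin> uminus ` \<nat>"
proof
  assume simple: "sl2_simple (V p)"
  show "poly p 0 \<notin> uminus ` \<nat>"
  proof
    assume "poly p 0 \<in> uminus ` \<nat>"
    \<comment> \<open>The value \<open>p(0) = -n\<close> corresponds to the exponent
      \<open>k = n + 1\<close>.\<close>
    then obtain n where "poly p 0 = 1 - of_nat (Suc n)" by (auto elim!: Nats_cases)
    note ideal = sl2_submodule_monom_ideal[OF this]
    let ?I = "{f. monom (1 :: 'a) (Suc n) dvd f}"
    have "?I = {0} \<or> ?I = UNIV"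
      using simple ideal by (simp add: sl2_simple_def V_simps(1))
    moreover have "1 \<notin> ?I" by (auto simp: degree_monom_eq dest: dvd_imp_degree_le)
    moreover have "monom 1 (Suc n) \<in> ?I" "monom (1 :: 'a) (Suc n) \<noteq> 0" by simp_all
    ultimately show False by blast
  qed
next
  assume p: "poly p 0 \<notin> uminus ` \<nat>"
  have "N = {0} \<or> N = UNIV" if N: "sl2_submodule N (V p)" for N
  proof (rule ccontr)
    assume "\<not> (N = {0} \<or> N = UNIV)"
    then obtain k where "k > 0" "poly p 0 = 1 - of_nat k"
      using sl2_submodule_V_cases[OF N] by blast
    then have "poly p 0 = - of_nat (k - 1)" by (simp add: of_nat_diff)
    then show False using p by auto
  qed
  moreover have "(UNIV :: 'a poly set) \<noteq> {0}" by (metis UNIV_I one_neq_zero singletonD)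
  ultimately show "sl2_simple (V p)" using sl2_module_V[of p] by (simp add: sl2_simple_def V_simps(1))
qed

text \<open>The only submodules are 0, \<open>(x^k)\<close> and the whole space. They form a strict
  chain, and three strict inclusions would need four distinct submodules.\<close>

lemma sl2_length_V:
  assumes p: "poly p 0 = 1 - of_nat k" and k: "k > 0"
  shows "sl2_length (V p) = 2"
proof -
  let ?I = "{f. monom (1 :: 'a) k dvd f}"
  have I: "{0} \<subset> ?I" "?I \<subset> UNIV"
  proof -
    have "monom 1 k \<in> ?I" "monom (1 :: 'a) k \<noteq> 0" "0 \<in> ?I" by auto
    then show "{0} \<subset> ?I" by blast
    have "1 \<notin> ?I" using k by (auto simp: degree_monom_eq dest: dvd_imp_degree_le)
    then show "?I \<subset> UNIV" by blast
  qed
  let ?chain = "\<lambda>n. \<exists>N. (\<forall>i\<le>n. sl2_submodule (N i) (V p)) \<and> (\<forall>i<n. N i \<subset> N (Suc i))"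
  have "n \<le> 2" if "?chain n" for n
  proof (rule ccontr)
    assume "\<not> n \<le> 2"
    then have "3 \<le> n" by simp
    with that obtain N where sub: "\<And>i. i \<le> 3 \<Longrightarrow> sl2_submodule (N i) (V p)"
      and "\<And>i. i < 3 \<Longrightarrow> N i \<subset> N (Suc i)" using le_trans less_le_trans by metis
    from this(2)[of 0] this(2)[of 1] this(2)[of 2]
    have less: "N 0 \<subset> N 1" "N 1 \<subset> N 2" "N 2 \<subset> N 3" by (simp_all add: numeral_eq_Suc)
    have "N i = {0} \<or> N i = ?I \<or> N i = UNIV" if "i \<le> 3" for i
      using V_submodule_trichotomy[OF p sub[OF that]] .
    from this[of 0] this[of 1] this[of 2] this[of 3] less I show False by auto
  qed
  moreover have "?chain 2"
  proof (intro exI[of _ "\<lambda>i. if i = 0 then {0} else if i = 1 then ?I else UNIV"] conjI allI impI)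
    fix i :: nat
    have "sl2_submodule {0} (V p)" "sl2_submodule UNIV (V p)"
      by (simp_all add: sl2_submodule_V_iff V_x_def V_h_def V_y_def)
    then show "sl2_submodule (if i = 0 then {0} else if i = 1 then ?I else UNIV) (V p)"
      using sl2_submodule_monom_ideal[OF p] by simp
  next
    fix i :: nat assume "i < 2"
    then have "i = 0 \<or> i = 1" by auto
    then show "(if i = 0 then {0} else if i = 1 then ?I else UNIV)
        \<subset> (if Suc i = 0 then {0} else if Suc i = 1 then ?I else UNIV)"
      using I by auto
  qed
  ultimately have "Sup {enat n |n. ?chain n} = enat 2"
  proof (intro antisym Sup_least Sup_upper)
    fix x assume "x \<in> {enat n |n. ?chain n}"
    then obtain n where "x = enat n" "?chain n" by blast
    with \<open>\<And>n. ?chain n \<Longrightarrow> n \<le> 2\<close> show "x \<le> enat 2" by (simp only: enat_ord_simps)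
  next
    show "enat 2 \<in> {enat n |n. ?chain n}" using \<open>?chain 2\<close> by blast
  qed
  then show ?thesis by (simp add: sl2_length_def numeral_eq_enat)
qed

theorem proposition8:
  fixes p :: "'a::{alg_closed_field, field_char_0} poly"
  shows "(sl2_simple (V p) \<longleftrightarrow> poly p 0 \<notin> uminus ` \<nat>) \<and>
    (poly p 0 \<in> uminus ` \<nat> \<longrightarrow>
      sl2_length (V p) = 2 \<and>
      (\<exists>(L :: ('a, 'a poly) sl2_mod) f g.
         simple_highest_weight (- poly p 0) L \<and>
         sl2_short_exact (V (p - [:2 * poly p 0:] + 2)) f (V p) g L))"
proof (intro conjI impI)
  show "sl2_simple (V p) \<longleftrightarrow> poly p 0 \<notin> uminus ` \<nat>" by (rule sl2_simple_V_iff)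
next
  assume "poly p 0 \<in> uminus ` \<nat>"
  then obtain n where p: "poly p 0 = 1 - of_nat (Suc n)" by (auto elim!: Nats_cases)
  show "sl2_length (V p) = 2" using sl2_length_V[OF p] by simp
  \<comment> \<open>With \<open>p(0) = -n\<close> the shift \<open>2 - 2 p(0)\<close> is
    \<open>2 (n + 1) = 2k\<close>.\<close>
  have "p - [:2 * poly p 0:] + 2 = p + of_nat (2 * Suc n)"
    by (simp add: p of_nat_poly numeral_poly)
  then show "\<exists>(L :: ('a, 'a poly) sl2_mod) f g. simple_highest_weight (- poly p 0) L \<and>
      sl2_short_exact (V (p - [:2 * poly p 0:] + 2)) f (V p) g L"
    using simple_highest_weight_V_quot[OF p] sl2_short_exact_V[OF p] by (metis zero_less_Suc)
qed

end
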